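(* Let $\mathcal L$ be the linear category of a model of linear logic. Then $\mathop{\mathrm{Inv}}\mathcal L$ is also the linear category of a model of linear logic.
   Context: A model of linear logic consists of: a $\ast$-autonomous category $(\mathcal L,\otimes,1,\bot)$ which also has binary products, written $A\,\&\,B$, and a terminal object $\top$; a Cartesian category $(\mathcal M,\times,T)$; and a linear-non-linear adjunction between them, i.e. a symmetric monoidal adjunction $(L,l,t)\dashv(M,m,u)$ between symmetric monoidal functors $(L,l,t):(\mathcal M,\times,T)\to(\mathcal L,\otimes,1)$ and $(M,m,u):(\mathcal L,\otimes,1)\to(\mathcal M,\times,T)$. The category $\mathcal L$ is called the linear category of the model. For a category $\mathcal A$, an object with involutions is a pair $(A,s)$ with $A$ an object of $\mathcal A$ and $s=(s_k)_{k\in\mathbb Z}$ a $\mathbb Z$-indexed sequence of involutions of $A$ (automorphisms with $s_k\circ s_k=id_A$); a morphism $(A,s)\to(B,t)$ is an arrow $f:A\to B$ of $\mathcal A$ with $t_k\circ f\circ s_k=f$ for all $k$. These form a category $\mathop{\mathrm{Inv}}\mathcal A$ (equivalently, the functor category $\mathcal A^{\mathcal I}$ where $\mathcal I$ is the free Coxeter group on $\mathbb Z$ seen as a one-object groupoid). When $(\mathcal A,\otimes,1)$ is symmetric monoidal, $\mathop{\mathrm{Inv}}\mathcal A$ is symmetric monoidal with $(A,s)\otimes'(B,t)=(A\otimes B,(s_k\otimes t_k)_k)$, unit $(1,(id_1)_k)$, and associator, unitors, symmetry inherited from $\mathcal A$; a functor $F$ acts as $(A,s)\mapsto(FA,(Fs_k)_k)$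 and as $F$ on morphisms, and natural transformations act componentwise. This defines a 2-endofunctor $\mathop{\mathrm{Inv}}$ of the 2-category of symmetric monoidal categories, symmetric monoidal functors and monoidal natural transformations. *)

theory Defs
  imports Main
begin

section \<open>Categories\<close>

record ('o, 'a) cat =
  Obj :: "'o set"
  Arr :: "'a set"
  Dom :: "'a \<Rightarrow> 'o"
  Cod :: "'a \<Rightarrow> 'o"
  Idn :: "'o \<Rightarrow> 'a"
  Comp :: "'a \<Rightarrow> 'a \<Rightarrow> 'a"  (infixr "\<cdot>\<index>" 55)

definition hom :: "('o, 'a, 'z) cat_scheme \<Rightarrow> 'o \<Rightarrow> 'o \<Rightarrow> 'a set" where
  "hom C A B = {f \<in> Arr C. Dom C f = A \<and> Cod C f = B}"

locale category =
  fixes C (structure)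
  assumes dom_obj: "f \<in> Arr C \<Longrightarrow> Dom C f \<in> Obj C"
    and cod_obj: "f \<in> Arr C \<Longrightarrow> Cod C f \<in> Obj C"
    and idn_hom: "A \<in> Obj C \<Longrightarrow> Idn C A \<in> hom C A A"
    and comp_hom: "f \<in> hom C A B \<Longrightarrow> g \<in> hom C B D \<Longrightarrow> g \<cdot> f \<in> hom C A D"
    and comp_idn: "f \<in> hom C A B \<Longrightarrow> f \<cdot> Idn C A = f"
    and idn_comp: "f \<in> hom C A B \<Longrightarrow> Idn C B \<cdot> f = f"
    and comp_assoc:
      "f \<in> hom C A B \<Longrightarrow> g \<in> hom C B D \<Longrightarrow> h \<in> hom C D E \<Longrightarrow> (h \<cdot> g) \<cdot> f = h \<cdot> (g \<cdot> f)"

definition is_iso :: "('o, 'a, 'z) cat_scheme \<Rightarrow> 'a \<Rightarrow> bool" where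
  "is_iso C f \<longleftrightarrow> f \<in> Arr C \<and>
     (\<exists>g \<in> hom C (Cod C f) (Dom C f).
        g \<cdot>\<^bsub>C\<^esub> f = Idn C (Dom C f) \<and> f \<cdot>\<^bsub>C\<^esub> g = Idn C (Cod C f))"

definition is_terminal :: "('o, 'a, 'z) cat_scheme \<Rightarrow> 'o \<Rightarrow> bool" where
  "is_terminal C T \<longleftrightarrow> T \<in> Obj C \<and> (\<forall>A \<in> Obj C. \<exists>!f. f \<in> hom C A T)"

definition is_product ::
    "('o, 'a, 'z) cat_scheme \<Rightarrow> 'o \<Rightarrow> 'o \<Rightarrow> 'o \<Rightarrow> 'a \<Rightarrow> 'a \<Rightarrow> bool" where
  "is_product C A B P p q \<longleftrightarrow>
     P \<in> Obj C \<and> p \<in> hom C P A \<and> q \<in> hom C P B \<and>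
     (\<forall>X \<in> Obj C. \<forall>f \<in> hom C X A. \<forall>g \<in> hom C X B.
        \<exists>!h. h \<in> hom C X P \<and> p \<cdot>\<^bsub>C\<^esub> h = f \<and> q \<cdot>\<^bsub>C\<^esub> h = g)"

definition has_binary_products :: "('o, 'a, 'z) cat_scheme \<Rightarrow> bool" where
  "has_binary_products C \<longleftrightarrow> (\<forall>A \<in> Obj C. \<forall>B \<in> Obj C. \<exists>P p q. is_product C A B P p q)"

definition has_terminal :: "('o, 'a, 'z) cat_scheme \<Rightarrow> bool" where
  "has_terminal C \<longleftrightarrow> (\<exists>T. is_terminal C T)"


section \<open>Symmetric monoidal categories\<close>

record ('o, 'a) smc = "('o, 'a) cat" +
  Tens :: "'o \<Rightarrow> 'o \<Rightarrow> 'o"  (infixr "\<otimes>\<index>" 70)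
  Tensa :: "'a \<Rightarrow> 'a \<Rightarrow> 'a"  (infixr "\<otimes>\<^sub>a\<index>" 70)
  Unit :: "'o"
  Assoc :: "'o \<Rightarrow> 'o \<Rightarrow> 'o \<Rightarrow> 'a"
  Lunit :: "'o \<Rightarrow> 'a"
  Runit :: "'o \<Rightarrow> 'a"
  Sym :: "'o \<Rightarrow> 'o \<Rightarrow> 'a"

locale symmetric_monoidal_category = category C
  for C :: "('o, 'a, 'z) smc_scheme" (structure) +
  assumes tens_obj: "A \<in> Obj C \<Longrightarrow> B \<in> Obj C \<Longrightarrow> A \<otimes> B \<in> Obj C"
    and tensa_hom: "f \<in> hom C A A' \<Longrightarrow> g \<in> hom C B B' \<Longrightarrow> f \<otimes>\<^sub>a g \<in> hom C (A \<otimes> B) (A' \<otimes> B')"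
    and tensa_idn: "A \<in> Obj C \<Longrightarrow> B \<in> Obj C \<Longrightarrow> Idn C A \<otimes>\<^sub>a Idn C B = Idn C (A \<otimes> B)"
    and tensa_comp:
      "f \<in> hom C A A' \<Longrightarrow> f' \<in> hom C A' A'' \<Longrightarrow> g \<in> hom C B B' \<Longrightarrow> g' \<in> hom C B' B'' \<Longrightarrow>
       (f' \<cdot> f) \<otimes>\<^sub>a (g' \<cdot> g) = (f' \<otimes>\<^sub>a g') \<cdot> (f \<otimes>\<^sub>a g)"
    and unit_obj: "Unit C \<in> Obj C"
    and assoc_hom:
      "A \<in> Obj C \<Longrightarrow> B \<in> Obj C \<Longrightarrow> D \<in> Obj C \<Longrightarrow>
       Assoc C A B D \<in> hom C ((A \<otimes> B) \<otimes> D) (A \<otimes> (B \<otimes> D))"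
    and assoc_iso:
      "A \<in> Obj C \<Longrightarrow> B \<in> Obj C \<Longrightarrow> D \<in> Obj C \<Longrightarrow> is_iso C (Assoc C A B D)"
    and assoc_nat:
      "f \<in> hom C A A' \<Longrightarrow> g \<in> hom C B B' \<Longrightarrow> h \<in> hom C D D' \<Longrightarrow>
       Assoc C A' B' D' \<cdot> ((f \<otimes>\<^sub>a g) \<otimes>\<^sub>a h) = (f \<otimes>\<^sub>a (g \<otimes>\<^sub>a h)) \<cdot> Assoc C A B D"
    and lunit_hom: "A \<in> Obj C \<Longrightarrow> Lunit C A \<in> hom C (Unit C \<otimes> A) A"
    and lunit_iso: "A \<in> Obj C \<Longrightarrow> is_iso C (Lunit C A)"
    and lunit_nat: "f \<in> hom C A B \<Longrightarrow> Lunit C B \<cdot> (Idn C (Unit C) \<otimes>\<^sub>a f) = f \<cdot> Lunit C A"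
    and runit_hom: "A \<in> Obj C \<Longrightarrow> Runit C A \<in> hom C (A \<otimes> Unit C) A"
    and runit_iso: "A \<in> Obj C \<Longrightarrow> is_iso C (Runit C A)"
    and runit_nat: "f \<in> hom C A B \<Longrightarrow> Runit C B \<cdot> (f \<otimes>\<^sub>a Idn C (Unit C)) = f \<cdot> Runit C A"
    and sym_hom: "A \<in> Obj C \<Longrightarrow> B \<in> Obj C \<Longrightarrow> Sym C A B \<in> hom C (A \<otimes> B) (B \<otimes> A)"
    and sym_nat:
      "f \<in> hom C A A' \<Longrightarrow> g \<in> hom C B B' \<Longrightarrow> Sym C A' B' \<cdot> (f \<otimes>\<^sub>a g) = (g \<otimes>\<^sub>a f) \<cdot> Sym C A B"
    and sym_sym: "A \<in> Obj C \<Longrightarrow> B \<in> Obj C \<Longrightarrow> Sym C B A \<cdot> Sym C A B = Idn C (A \<otimes> B)"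
    and pentagon:
      "A \<in> Obj C \<Longrightarrow> B \<in> Obj C \<Longrightarrow> D \<in> Obj C \<Longrightarrow> E \<in> Obj C \<Longrightarrow>
       (Idn C A \<otimes>\<^sub>a Assoc C B D E) \<cdot> Assoc C A (B \<otimes> D) E \<cdot> (Assoc C A B D \<otimes>\<^sub>a Idn C E)
       = Assoc C A B (D \<otimes> E) \<cdot> Assoc C (A \<otimes> B) D E"
    and triangle:
      "A \<in> Obj C \<Longrightarrow> B \<in> Obj C \<Longrightarrow>
       (Idn C A \<otimes>\<^sub>a Lunit C B) \<cdot> Assoc C A (Unit C) B = Runit C A \<otimes>\<^sub>a Idn C B"
    and hexagon:
      "A \<in> Obj C \<Longrightarrow> B \<in> Obj C \<Longrightarrow> D \<in> Obj C \<Longrightarrow>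
       Assoc C B D A \<cdot> Sym C A (B \<otimes> D) \<cdot> Assoc C A B D
       = (Idn C B \<otimes>\<^sub>a Sym C A D) \<cdot> Assoc C B A D \<cdot> (Sym C A B \<otimes>\<^sub>a Idn C D)"

text \<open>A Cartesian category, seen as a symmetric monoidal category: the tensor is a chosen binary
  product, the unit a terminal object, and the equations say that the tensor of arrows and all the
  structural isomorphisms are the canonical ones given by the universal property.\<close>

locale cartesian_category = symmetric_monoidal_category C
  for C :: "('o, 'a, 'z) smc_scheme" (structure) +
  fixes pr1 pr2 :: "'o \<Rightarrow> 'o \<Rightarrow> 'a"
  assumes unit_terminal: "is_terminal C (Unit C)"
    and tens_product:
      "A \<in> Obj C \<Longrightarrow> B \<in> Obj C \<Longrightarrow> is_product C A B (A \<otimes> B) (pr1 A B) (pr2 A B)"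
    and pr1_tensa:
      "f \<in> hom C A A' \<Longrightarrow> g \<in> hom C B B' \<Longrightarrow> pr1 A' B' \<cdot> (f \<otimes>\<^sub>a g) = f \<cdot> pr1 A B"
    and pr2_tensa:
      "f \<in> hom C A A' \<Longrightarrow> g \<in> hom C B B' \<Longrightarrow> pr2 A' B' \<cdot> (f \<otimes>\<^sub>a g) = g \<cdot> pr2 A B"
    and pr1_assoc:
      "A \<in> Obj C \<Longrightarrow> B \<in> Obj C \<Longrightarrow> D \<in> Obj C \<Longrightarrow>
       pr1 A (B \<otimes> D) \<cdot> Assoc C A B D = pr1 A B \<cdot> pr1 (A \<otimes> B) D"
    and pr1_pr2_assoc:
      "A \<in> Obj C \<Longrightarrow> B \<in> Obj C \<Longrightarrow> D \<in> Obj C \<Longrightarrow>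
       pr1 B D \<cdot> pr2 A (B \<otimes> D) \<cdot> Assoc C A B D = pr2 A B \<cdot> pr1 (A \<otimes> B) D"
    and pr2_pr2_assoc:
      "A \<in> Obj C \<Longrightarrow> B \<in> Obj C \<Longrightarrow> D \<in> Obj C \<Longrightarrow>
       pr2 B D \<cdot> pr2 A (B \<otimes> D) \<cdot> Assoc C A B D = pr2 (A \<otimes> B) D"
    and lunit_pr2: "A \<in> Obj C \<Longrightarrow> Lunit C A = pr2 (Unit C) A"
    and runit_pr1: "A \<in> Obj C \<Longrightarrow> Runit C A = pr1 A (Unit C)"
    and pr1_sym: "A \<in> Obj C \<Longrightarrow> B \<in> Obj C \<Longrightarrow> pr1 B A \<cdot> Sym C A B = pr2 A B"
    and pr2_sym: "A \<in> Obj C \<Longrightarrow> B \<in> Obj C \<Longrightarrow> pr2 B A \<cdot> Sym C A B = pr1 A B"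


section \<open>\<open>*\<close>-autonomous categories\<close>

locale symmetric_monoidal_closed_category = symmetric_monoidal_category C
  for C :: "('o, 'a, 'z) smc_scheme" (structure) +
  fixes ihom :: "'o \<Rightarrow> 'o \<Rightarrow> 'o"
    and ev :: "'o \<Rightarrow> 'o \<Rightarrow> 'a"
  assumes ihom_obj: "A \<in> Obj C \<Longrightarrow> B \<in> Obj C \<Longrightarrow> ihom A B \<in> Obj C"
    and ev_hom: "A \<in> Obj C \<Longrightarrow> B \<in> Obj C \<Longrightarrow> ev A B \<in> hom C (ihom A B \<otimes> A) B"
    and ev_universal:
      "X \<in> Obj C \<Longrightarrow> A \<in> Obj C \<Longrightarrow> B \<in> Obj C \<Longrightarrow> f \<in> hom C (X \<otimes> A) B \<Longrightarrow>
       \<exists>!g. g \<in> hom C X (ihom A B) \<and> ev A B \<cdot> (g \<otimes>\<^sub>a Idn C A) = f"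
begin

definition curry :: "'o \<Rightarrow> 'o \<Rightarrow> 'o \<Rightarrow> 'a \<Rightarrow> 'a" where
  "curry X A B f = (THE g. g \<in> hom C X (ihom A B) \<and> ev A B \<cdot> (g \<otimes>\<^sub>a Idn C A) = f)"

text \<open>The canonical arrow from \<open>A\<close> to its double dual with respect to the object \<open>Z\<close>.\<close>

definition bidual :: "'o \<Rightarrow> 'o \<Rightarrow> 'a" where
  "bidual Z A = curry A (ihom A Z) Z (ev A Z \<cdot> Sym C A (ihom A Z))"

end

locale star_autonomous_category = symmetric_monoidal_closed_category C ihom ev
  for C :: "('o, 'a, 'z) smc_scheme" (structure) and ihom ev +
  fixes bot :: 'o
  assumes bot_obj: "bot \<in> Obj C"
    and bidual_iso: "A \<in> Obj C \<Longrightarrow> is_iso C (bidual bot A)"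


section \<open>Symmetric monoidal functors and adjunctions\<close>

text \<open>Symmetric monoidal functors are lax: \<open>FMult F A B\<close> is an arrow from \<open>F A \<otimes> F B\<close> to
  \<open>F (A \<otimes> B)\<close> and \<open>FUnit F\<close> an arrow from the unit to the image of the unit.\<close>

record ('o, 'a, 'p, 'b) smfunctor =
  FObj :: "'o \<Rightarrow> 'p"
  FArr :: "'a \<Rightarrow> 'b"
  FMult :: "'o \<Rightarrow> 'o \<Rightarrow> 'b"
  FUnit :: "'b"

locale symmetric_monoidal_functor =
  source: symmetric_monoidal_category C + target: symmetric_monoidal_category D
  for C :: "('o, 'a, 'y) smc_scheme" and D :: "('p, 'b, 'z) smc_scheme" +
  fixes F :: "('o, 'a, 'p, 'b) smfunctor"
  assumes fobj: "A \<in> Obj C \<Longrightarrow> FObj F A \<in> Obj D"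
    and farr_hom: "f \<in> hom C A B \<Longrightarrow> FArr F f \<in> hom D (FObj F A) (FObj F B)"
    and farr_idn: "A \<in> Obj C \<Longrightarrow> FArr F (Idn C A) = Idn D (FObj F A)"
    and farr_comp:
      "f \<in> hom C A B \<Longrightarrow> g \<in> hom C B E \<Longrightarrow> FArr F (g \<cdot>\<^bsub>C\<^esub> f) = FArr F g \<cdot>\<^bsub>D\<^esub> FArr F f"
    and fmult_hom:
      "A \<in> Obj C \<Longrightarrow> B \<in> Obj C \<Longrightarrow>
       FMult F A B \<in> hom D (FObj F A \<otimes>\<^bsub>D\<^esub> FObj F B) (FObj F (A \<otimes>\<^bsub>C\<^esub> B))"
    and fmult_nat:
      "f \<in> hom C A A' \<Longrightarrow> g \<in> hom C B B' \<Longrightarrow>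
       FMult F A' B' \<cdot>\<^bsub>D\<^esub> (FArr F f \<otimes>\<^sub>a\<^bsub>D\<^esub> FArr F g) = FArr F (f \<otimes>\<^sub>a\<^bsub>C\<^esub> g) \<cdot>\<^bsub>D\<^esub> FMult F A B"
    and funit_hom: "FUnit F \<in> hom D (Unit D) (FObj F (Unit C))"
    and fmult_assoc:
      "A \<in> Obj C \<Longrightarrow> B \<in> Obj C \<Longrightarrow> E \<in> Obj C \<Longrightarrow>
       FArr F (Assoc C A B E) \<cdot>\<^bsub>D\<^esub> FMult F (A \<otimes>\<^bsub>C\<^esub> B) E
         \<cdot>\<^bsub>D\<^esub> (FMult F A B \<otimes>\<^sub>a\<^bsub>D\<^esub> Idn D (FObj F E))
       = FMult F A (B \<otimes>\<^bsub>C\<^esub> E) \<cdot>\<^bsub>D\<^esub> (Idn D (FObj F A) \<otimes>\<^sub>a\<^bsub>D\<^esub> FMult F B E)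
         \<cdot>\<^bsub>D\<^esub> Assoc D (FObj F A) (FObj F B) (FObj F E)"
    and fmult_lunit:
      "A \<in> Obj C \<Longrightarrow>
       FArr F (Lunit C A) \<cdot>\<^bsub>D\<^esub> FMult F (Unit C) A \<cdot>\<^bsub>D\<^esub> (FUnit F \<otimes>\<^sub>a\<^bsub>D\<^esub> Idn D (FObj F A))
       = Lunit D (FObj F A)"
    and fmult_runit:
      "A \<in> Obj C \<Longrightarrow>
       FArr F (Runit C A) \<cdot>\<^bsub>D\<^esub> FMult F A (Unit C) \<cdot>\<^bsub>D\<^esub> (Idn D (FObj F A) \<otimes>\<^sub>a\<^bsub>D\<^esub> FUnit F)
       = Runit D (FObj F A)"
    and fmult_sym:
      "A \<in> Obj C \<Longrightarrow> B \<in> Obj C \<Longrightarrow>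
       FArr F (Sym C A B) \<cdot>\<^bsub>D\<^esub> FMult F A B = FMult F B A \<cdot>\<^bsub>D\<^esub> Sym D (FObj F A) (FObj F B)"

definition id_smfunctor :: "('o, 'a, 'z) smc_scheme \<Rightarrow> ('o, 'a, 'o, 'a) smfunctor" where
  "id_smfunctor C =
     \<lparr> FObj = (\<lambda>A. A), FArr = (\<lambda>f. f),
       FMult = (\<lambda>A B. Idn C (A \<otimes>\<^bsub>C\<^esub> B)), FUnit = Idn C (Unit C) \<rparr>"

text \<open>The composite \<open>G \<circ> F\<close>; the first argument is the target category of \<open>G\<close>.\<close>

definition comp_smfunctor ::
    "('q, 'c, 'z) smc_scheme \<Rightarrow> ('p, 'b, 'q, 'c) smfunctor \<Rightarrow> ('o, 'a, 'p, 'b) smfunctor \<Rightarrow>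
     ('o, 'a, 'q, 'c) smfunctor" where
  "comp_smfunctor E G F =
     \<lparr> FObj = (\<lambda>A. FObj G (FObj F A)), FArr = (\<lambda>f. FArr G (FArr F f)),
       FMult = (\<lambda>A B. FArr G (FMult F A B) \<cdot>\<^bsub>E\<^esub> FMult G (FObj F A) (FObj F B)),
       FUnit = FArr G (FUnit F) \<cdot>\<^bsub>E\<^esub> FUnit G \<rparr>"

locale monoidal_transformation =
  F: symmetric_monoidal_functor C D F + G: symmetric_monoidal_functor C D G
  for C :: "('o, 'a, 'y) smc_scheme" and D :: "('p, 'b, 'z) smc_scheme" and F G +
  fixes \<alpha> :: "'o \<Rightarrow> 'b"
  assumes component_hom: "A \<in> Obj C \<Longrightarrow> \<alpha> A \<in> hom D (FObj F A) (FObj G A)"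
    and naturality: "f \<in> hom C A B \<Longrightarrow> \<alpha> B \<cdot>\<^bsub>D\<^esub> FArr F f = FArr G f \<cdot>\<^bsub>D\<^esub> \<alpha> A"
    and component_mult:
      "A \<in> Obj C \<Longrightarrow> B \<in> Obj C \<Longrightarrow>
       \<alpha> (A \<otimes>\<^bsub>C\<^esub> B) \<cdot>\<^bsub>D\<^esub> FMult F A B = FMult G A B \<cdot>\<^bsub>D\<^esub> (\<alpha> A \<otimes>\<^sub>a\<^bsub>D\<^esub> \<alpha> B)"
    and component_unit: "\<alpha> (Unit C) \<cdot>\<^bsub>D\<^esub> FUnit F = FUnit G"

text \<open>\<open>F\<close> is left adjoint to \<open>G\<close>, with unit \<open>\<eta>\<close> and counit \<open>\<epsilon>\<close>.\<close>

locale symmetric_monoidal_adjunction =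
  left: symmetric_monoidal_functor C D F + right: symmetric_monoidal_functor D C G +
  unit: monoidal_transformation C C "id_smfunctor C" "comp_smfunctor C G F" \<eta> +
  counit: monoidal_transformation D D "comp_smfunctor D F G" "id_smfunctor D" \<epsilon>
  for C :: "('o, 'a, 'y) smc_scheme" and D :: "('p, 'b, 'z) smc_scheme" and F G \<eta> \<epsilon> +
  assumes triangle_left:
      "A \<in> Obj C \<Longrightarrow> \<epsilon> (FObj F A) \<cdot>\<^bsub>D\<^esub> FArr F (\<eta> A) = Idn D (FObj F A)"
    and triangle_right:
      "B \<in> Obj D \<Longrightarrow> FArr G (\<epsilon> B) \<cdot>\<^bsub>C\<^esub> \<eta> (FObj G B) = Idn C (FObj G B)"


section \<open>Models of linear logic\<close>

locale linear_logic_model =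
  linear: star_autonomous_category \<L> ihom ev bot +
  nonlinear: cartesian_category \<M> pr1 pr2 +
  adjunction: symmetric_monoidal_adjunction \<M> \<L> L M \<eta> \<epsilon>
  for \<L> :: "('o, 'a) smc" and ihom ev bot
    and \<M> :: "('p, 'b) smc" and pr1 pr2
    and L M \<eta> \<epsilon> +
  assumes linear_products: "has_binary_products \<L>"
    and linear_terminal: "has_terminal \<L>"

text \<open>HOL has no quantification over types, so the types of the objects and of the arrows of the
  Cartesian category are parameters.\<close>

definition linear_category_of_model ::
    "'p itself \<Rightarrow> 'b itself \<Rightarrow> ('o, 'a) smc \<Rightarrow> bool" where
  "linear_category_of_model _ _ \<L> \<longleftrightarrow>
     (\<exists>ihom ev bot (\<M> :: ('p, 'b) smc) pr1 pr2 L M \<eta> \<epsilon>.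
        linear_logic_model \<L> ihom ev bot \<M> pr1 pr2 L M \<eta> \<epsilon>)"


section \<open>Objects with involutions\<close>

type_synonym ('o, 'a) iobj = "'o \<times> (int \<Rightarrow> 'a)"

text \<open>The same arrow of the base category can be a morphism between several pairs of objects with
  involutions, so arrows carry their domain and codomain.\<close>

type_synonym ('o, 'a) iarr = "('o, 'a) iobj \<times> 'a \<times> ('o, 'a) iobj"

definition inv_obj :: "('o, 'a, 'z) cat_scheme \<Rightarrow> ('o, 'a) iobj set" where
  "inv_obj C =
     {(A, s). A \<in> Obj C \<and> (\<forall>k. s k \<in> hom C A A \<and> s k \<cdot>\<^bsub>C\<^esub> s k = Idn C A)}"

definition inv_arr :: "('o, 'a, 'z) cat_scheme \<Rightarrow> ('o, 'a) iarr set" where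
  "inv_arr C =
     {((A, s), f, (B, t)) | A s f B t.
        (A, s) \<in> inv_obj C \<and> (B, t) \<in> inv_obj C \<and> f \<in> hom C A B \<and>
        (\<forall>k. t k \<cdot>\<^bsub>C\<^esub> f \<cdot>\<^bsub>C\<^esub> s k = f)}"

definition inv_tens ::
    "('o, 'a, 'z) smc_scheme \<Rightarrow> ('o, 'a) iobj \<Rightarrow> ('o, 'a) iobj \<Rightarrow> ('o, 'a) iobj" where
  "inv_tens C = (\<lambda>(A, s) (B, t). (A \<otimes>\<^bsub>C\<^esub> B, \<lambda>k. s k \<otimes>\<^sub>a\<^bsub>C\<^esub> t k))"

definition inv_unit :: "('o, 'a, 'z) smc_scheme \<Rightarrow> ('o, 'a) iobj" where
  "inv_unit C = (Unit C, \<lambda>k. Idn C (Unit C))"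

definition Inv :: "('o, 'a) smc \<Rightarrow> (('o, 'a) iobj, ('o, 'a) iarr) smc" where
  "Inv C =
     \<lparr> Obj = inv_obj C,
       Arr = inv_arr C,
       Dom = (\<lambda>(X, f, Y). X),
       Cod = (\<lambda>(X, f, Y). Y),
       Idn = (\<lambda>X. (X, Idn C (fst X), X)),
       Comp = (\<lambda>(Y', g, Z) (X, f, Y). (X, g \<cdot>\<^bsub>C\<^esub> f, Z)),
       Tens = inv_tens C,
       Tensa = (\<lambda>(X, f, X') (Y, g, Y'). (inv_tens C X Y, f \<otimes>\<^sub>a\<^bsub>C\<^esub> g, inv_tens C X' Y')),
       Unit = inv_unit C,
       Assoc = (\<lambda>X Y Z. (inv_tens C (inv_tens C X Y) Z,
                         Assoc C (fst X) (fst Y) (fst Z),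
                         inv_tens C X (inv_tens C Y Z))),
       Lunit = (\<lambda>X. (inv_tens C (inv_unit C) X, Lunit C (fst X), X)),
       Runit = (\<lambda>X. (inv_tens C X (inv_unit C), Runit C (fst X), X)),
       Sym = (\<lambda>X Y. (inv_tens C X Y, Sym C (fst X) (fst Y), inv_tens C Y X)) \<rparr>"

end

theory Submission
  imports Defs
begin

text \<open>Every piece of structure of a model of linear logic lifts along the faithful functor from
  \<open>Inv C\<close> to \<open>C\<close>: for structure given by a universal property, the involutions on the
  constructed object are induced by that property, and the structural arrows and mediating arrows
  are equivariant by uniqueness or naturality. Equations and invertibility are then inherited from
  \<open>C\<close>. The nonlinear category of the new model is \<open>Inv \<M>\<close>, and since \<open>Inv\<close> preserves identities
  and composites of functors, it sends the adjunction to an adjunction.\<close>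

section \<open>Equivariant arrows\<close>

text \<open>The condition \<open>t k \<cdot> f \<cdot> s k = f\<close> of \<open>inv_arr\<close> in
  intertwining form, which passes through composition, tensors and functors by plain rewriting.
  Membership of both objects is included so that a single fact supplies all the typing.\<close>

definition equivariant ::
    "('o, 'a, 'z) cat_scheme \<Rightarrow> ('o, 'a) iobj \<Rightarrow> ('o, 'a) iobj \<Rightarrow> 'a \<Rightarrow> bool" where
  "equivariant C X Y f \<longleftrightarrow>
     X \<in> inv_obj C \<and> Y \<in> inv_obj C \<and> f \<in> hom C (fst X) (fst Y) \<and>
     (\<forall>k. snd Y k \<cdot>\<^bsub>C\<^esub> f = f \<cdot>\<^bsub>C\<^esub> snd X k)"

lemma equivariantI:
  assumes "X \<in> inv_obj C" "Y \<in> inv_obj C" "f \<in> hom C (fst X) (fst Y)"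
    and "\<And>k. snd Y k \<cdot>\<^bsub>C\<^esub> f = f \<cdot>\<^bsub>C\<^esub> snd X k"
  shows "equivariant C X Y f"
  using assms by (simp add: equivariant_def)

lemma equivariantD:
  assumes "equivariant C X Y f"
  shows "X \<in> inv_obj C" "Y \<in> inv_obj C" "f \<in> hom C (fst X) (fst Y)"
    and "snd Y k \<cdot>\<^bsub>C\<^esub> f = f \<cdot>\<^bsub>C\<^esub> snd X k"
  using assms by (simp_all add: equivariant_def)

lemma inv_objI:
  assumes "A \<in> Obj C" "\<And>k. s k \<in> hom C A A" "\<And>k. s k \<cdot>\<^bsub>C\<^esub> s k = Idn C A"
  shows "(A, s) \<in> inv_obj C"
  using assms by (simp add: inv_obj_def)

lemma inv_objD:
  assumes "X \<in> inv_obj C"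
  shows "fst X \<in> Obj C" "snd X k \<in> hom C (fst X) (fst X)"
    and "snd X k \<cdot>\<^bsub>C\<^esub> snd X k = Idn C (fst X)"
  using assms by (auto simp: inv_obj_def)

lemma Inv_simps [simp]:
  "Obj (Inv C) = inv_obj C"
  "Arr (Inv C) = inv_arr C"
  "Dom (Inv C) (X, f, Y) = X"
  "Cod (Inv C) (X, f, Y) = Y"
  "Idn (Inv C) X = (X, Idn C (fst X), X)"
  "(Y', g, Z) \<cdot>\<^bsub>Inv C\<^esub> (X, f, Y) = (X, g \<cdot>\<^bsub>C\<^esub> f, Z)"
  "X \<otimes>\<^bsub>Inv C\<^esub> Y = inv_tens C X Y"
  "(X, f, X') \<otimes>\<^sub>a\<^bsub>Inv C\<^esub> (Y, g, Y') = (inv_tens C X Y, f \<otimes>\<^sub>a\<^bsub>C\<^esub> g, inv_tens C X' Y')"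
  "Unit (Inv C) = inv_unit C"
  "Assoc (Inv C) X Y Z = (inv_tens C (inv_tens C X Y) Z, Assoc C (fst X) (fst Y) (fst Z),
     inv_tens C X (inv_tens C Y Z))"
  "Lunit (Inv C) X = (inv_tens C (inv_unit C) X, Lunit C (fst X), X)"
  "Runit (Inv C) X = (inv_tens C X (inv_unit C), Runit C (fst X), X)"
  "Sym (Inv C) X Y = (inv_tens C X Y, Sym C (fst X) (fst Y), inv_tens C Y X)"
  by (simp_all add: Inv_def)

lemma inv_tens_sel [simp]:
  "fst (inv_tens C X Y) = fst X \<otimes>\<^bsub>C\<^esub> fst Y"
  "snd (inv_tens C X Y) k = snd X k \<otimes>\<^sub>a\<^bsub>C\<^esub> snd Y k"
  by (simp_all add: inv_tens_def split: prod.splits)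

lemma inv_unit_sel [simp]:
  "fst (inv_unit C) = Unit C"
  "snd (inv_unit C) k = Idn C (Unit C)"
  by (simp_all add: inv_unit_def)

context category
begin

text \<open>An involution is its own inverse: composing with \<open>t\<close> on the left strips it
  from the conjugate, and in the other direction \<open>s \<cdot> s\<close> cancels.\<close>

lemma commutes_involution_iff:
  assumes "s \<in> hom C A A" "s \<cdot> s = Idn C A" "t \<in> hom C B B" "t \<cdot> t = Idn C B" "f \<in> hom C A B"
  shows "t \<cdot> f \<cdot> s = f \<longleftrightarrow> t \<cdot> f = f \<cdot> s"
proof
  assume "t \<cdot> f \<cdot> s = f"
  then have "t \<cdot> f = t \<cdot> t \<cdot> f \<cdot> s" by simp
  also have "\<dots> = (t \<cdot> t) \<cdot> f \<cdot> s"
    using comp_assoc[OF comp_hom[OF assms(1,5)] assms(3,3)] by simp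
  also have "\<dots> = f \<cdot> s"
    using idn_comp[OF comp_hom[OF assms(1,5)]] assms(4) by simp
  finally show "t \<cdot> f = f \<cdot> s" .
next
  assume eq: "t \<cdot> f = f \<cdot> s"
  have "t \<cdot> f \<cdot> s = (t \<cdot> f) \<cdot> s"
    using comp_assoc[OF assms(1,5,3)] by simp
  also have "\<dots> = f \<cdot> s \<cdot> s"
    using comp_assoc[OF assms(1,1,5)] eq by simp
  finally show "t \<cdot> f \<cdot> s = f"
    using comp_idn[OF assms(5)] assms(2) by simp
qed

lemma inv_arr_iff: "(X, f, Y) \<in> inv_arr C \<longleftrightarrow> equivariant C X Y f"
proof (cases X; cases Y)
  fix A s B t
  assume "X = (A, s)" "Y = (B, t)"
  then show ?thesis
    using commutes_involution_iff[of "s _" A "t _" B f]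
    by (fastforce simp: inv_arr_def equivariant_def inv_obj_def)
qed

lemma equivariant_idn: "X \<in> inv_obj C \<Longrightarrow> equivariant C X X (Idn C (fst X))"
  by (rule equivariantI) (simp_all add: inv_objD idn_hom comp_idn[OF inv_objD(2)] idn_comp[OF inv_objD(2)])

lemma equivariant_comp:
  assumes f: "equivariant C X Y f" and g: "equivariant C Y Z g"
  shows "equivariant C X Z (g \<cdot> f)"
proof (rule equivariantI)
  note fD = equivariantD[OF f] and gD = equivariantD[OF g]
  show "g \<cdot> f \<in> hom C (fst X) (fst Z)"
    using comp_hom[OF fD(3) gD(3)] .
  fix k
  have "snd Z k \<cdot> g \<cdot> f = (snd Z k \<cdot> g) \<cdot> f"
    using comp_assoc[OF fD(3) gD(3) inv_objD(2)[OF gD(2)]] by simp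
  also have "\<dots> = g \<cdot> snd Y k \<cdot> f"
    using comp_assoc[OF fD(3) inv_objD(2)[OF fD(2)] gD(3)] gD(4) by simp
  also have "\<dots> = (g \<cdot> f) \<cdot> snd X k"
    using comp_assoc[OF inv_objD(2)[OF fD(1)] fD(3) gD(3)] fD(4) by simp
  finally show "snd Z k \<cdot> g \<cdot> f = (g \<cdot> f) \<cdot> snd X k" .
qed (use f g in \<open>simp_all add: equivariant_def\<close>)

text \<open>This is why the forgetful functor to \<open>C\<close> reflects isomorphisms. Insert
  \<open>g \<cdot> f\<close> in front of \<open>snd X k \<cdot> g\<close>, move \<open>f\<close>
  past the involution, and cancel \<open>f \<cdot> g\<close>.\<close>

lemma equivariant_inverse:
  assumes f: "equivariant C X Y f" and g: "g \<in> hom C (fst Y) (fst X)"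
    and gf: "g \<cdot> f = Idn C (fst X)" and fg: "f \<cdot> g = Idn C (fst Y)"
  shows "equivariant C Y X g"
proof (rule equivariantI)
  note fD = equivariantD[OF f]
  note s = inv_objD(2)[OF fD(1)] and t = inv_objD(2)[OF fD(2)]
  fix k
  have "snd X k \<cdot> g = (g \<cdot> f) \<cdot> snd X k \<cdot> g"
    using idn_comp[OF comp_hom[OF g s]] gf by simp
  also have "\<dots> = g \<cdot> (f \<cdot> snd X k) \<cdot> g"
    using comp_assoc[OF comp_hom[OF g s] fD(3) g] comp_assoc[OF g s fD(3)] by simp
  also have "\<dots> = g \<cdot> (snd Y k \<cdot> f) \<cdot> g"
    using fD(4) by simp
  also have "\<dots> = g \<cdot> snd Y k"
    using comp_assoc[OF g fD(3) t] comp_idn[OF t] fg by simp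
  finally show "snd X k \<cdot> g = g \<cdot> snd Y k" .
qed (use f g in \<open>simp_all add: equivariant_def\<close>)

end

section \<open>The category of objects with involutions\<close>

lemma hom_Inv:
  assumes "category C"
  shows "u \<in> hom (Inv C) X Y \<longleftrightarrow> (\<exists>f. u = (X, f, Y) \<and> equivariant C X Y f)"
  by (cases u) (auto simp: hom_def category.inv_arr_iff[OF assms])

lemma hom_Inv_triple:
  assumes "category C"
  shows "(X', f, Y') \<in> hom (Inv C) X Y \<longleftrightarrow> X' = X \<and> Y' = Y \<and> equivariant C X Y f"
  by (auto simp: hom_Inv[OF assms])

lemma category_Inv:
  assumes "category C"
  shows "category (Inv C)"
proof -
  interpret category C by fact
  show ?thesis
  proof (unfold_locales, goal_cases)
    case (1 f) then show ?case by (cases f) (auto simp: inv_arr_iff dest: equivariantD)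
  next
    case (2 f) then show ?case by (cases f) (auto simp: inv_arr_iff dest: equivariantD)
  next
    case (3 A) then show ?case by (simp add: hom_Inv[OF assms] equivariant_idn)
  next
    case (4 f A B g D) then show ?case by (auto simp: hom_Inv[OF assms] equivariant_comp)
  next
    case (5 f A B) then show ?case
      by (auto simp: hom_Inv[OF assms] comp_idn[OF equivariantD(3)])
  next
    case (6 f A B) then show ?case
      by (auto simp: hom_Inv[OF assms] idn_comp[OF equivariantD(3)])
  next
    case (7 f A B g D h E) then show ?case
      by (auto simp: hom_Inv[OF assms] comp_assoc[OF equivariantD(3) equivariantD(3) equivariantD(3)])
  qed
qed

lemma is_iso_Inv:
  assumes "category C" and f: "equivariant C X Y f" and iso: "is_iso C f"
  shows "is_iso (Inv C) (X, f, Y)"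
proof -
  interpret category C by fact
  obtain g where g: "g \<in> hom C (fst Y) (fst X)"
    "g \<cdot>\<^bsub>C\<^esub> f = Idn C (fst X)" "f \<cdot>\<^bsub>C\<^esub> g = Idn C (fst Y)"
    using iso equivariantD(3)[OF f] by (auto simp: is_iso_def hom_def)
  then have "equivariant C Y X g"
    using equivariant_inverse[OF f] by simp
  then have "(Y, g, X) \<in> hom (Inv C) Y X"
    by (simp add: hom_Inv_triple[OF assms(1)])
  then show ?thesis
    using f g by (auto simp: is_iso_def inv_arr_iff intro!: bexI[of _ "(Y, g, X)"])
qed


section \<open>Products and terminal objects\<close>

text \<open>Any two arrows into \<open>T\<close> with the same domain agree, so equivariance is
  automatic, and the identity is the only candidate for the involutions.\<close>

lemma is_terminal_Inv:
  assumes "category C" and T: "is_terminal C T"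
  shows "is_terminal (Inv C) (T, \<lambda>k. Idn C T)"
proof -
  interpret category C by fact
  have TO: "T \<in> Obj C" and ex: "\<And>A. A \<in> Obj C \<Longrightarrow> \<exists>f. f \<in> hom C A T"
    and uniq: "\<And>A f g. A \<in> Obj C \<Longrightarrow> f \<in> hom C A T \<Longrightarrow> g \<in> hom C A T \<Longrightarrow> f = g"
    using T by (auto simp: is_terminal_def)
  have TI: "(T, \<lambda>k. Idn C T) \<in> inv_obj C"
    using TO by (intro inv_objI) (auto simp: idn_hom comp_idn[OF idn_hom])
  have "\<exists>!u. u \<in> hom (Inv C) X (T, \<lambda>k. Idn C T)" if X: "X \<in> inv_obj C" for X
  proof -
    obtain f where f: "f \<in> hom C (fst X) T"
      using ex[OF inv_objD(1)[OF X]] by blast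
    have "equivariant C X (T, \<lambda>k. Idn C T) f"
    proof (rule equivariantI)
      fix k show "snd (T, \<lambda>k. Idn C T) k \<cdot>\<^bsub>C\<^esub> f = f \<cdot>\<^bsub>C\<^esub> snd X k"
        using uniq[OF inv_objD(1)[OF X] f comp_hom[OF inv_objD(2)[OF X] f]] idn_comp[OF f] by simp
    qed (use X TI f in auto)
    moreover have "g = f" if "equivariant C X (T, \<lambda>k. Idn C T) g" for g
      using uniq[OF inv_objD(1)[OF X] _ f] equivariantD(3)[OF that] by simp
    ultimately show ?thesis
      unfolding hom_Inv[OF assms(1)] by blast
  qed
  then show ?thesis
    using TI by (simp add: is_terminal_def)
qed

text \<open>Joint monicity of the projections: the composites with \<open>h'\<close> form a cone
  through which both \<open>h\<close> and \<open>h'\<close> factor.\<close>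

lemma is_product_ext:
  assumes P: "is_product C A B P p q" and X: "X \<in> Obj C"
    and "h \<in> hom C X P" "h' \<in> hom C X P"
    and "p \<cdot>\<^bsub>C\<^esub> h = p \<cdot>\<^bsub>C\<^esub> h'" "q \<cdot>\<^bsub>C\<^esub> h = q \<cdot>\<^bsub>C\<^esub> h'"
    and "p \<cdot>\<^bsub>C\<^esub> h' \<in> hom C X A" "q \<cdot>\<^bsub>C\<^esub> h' \<in> hom C X B"
  shows "h = h'"
  using assms unfolding is_product_def by metis

text \<open>The lift \<open>Z\<close> of the product object is taken as given, so that the lemma
  serves both the induced involutions in \<open>has_binary_products_Inv\<close> and the tensor in
  \<open>cartesian_category_Inv\<close>. The mediating arrow of \<open>C\<close> is equivariant
  because its two composites with the involutions have equal projections.\<close>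

lemma is_product_Inv:
  assumes "category C" and P: "is_product C (fst X) (fst Y) (fst Z) p q"
    and p: "equivariant C Z X p" and q: "equivariant C Z Y q"
  shows "is_product (Inv C) X Y Z (Z, p, X) (Z, q, Y)"
proof -
  interpret category C by fact
  note pD = equivariantD[OF p] and qD = equivariantD[OF q]
  have mediating: "\<exists>!u. u \<in> hom (Inv C) W Z \<and> (Z, p, X) \<cdot>\<^bsub>Inv C\<^esub> u = (W, f, X) \<and> (Z, q, Y) \<cdot>\<^bsub>Inv C\<^esub> u = (W, g, Y)"
    if f: "equivariant C W X f" and g: "equivariant C W Y g" for W f g
  proof -
    note fD = equivariantD[OF f] and gD = equivariantD[OF g]
    note W = inv_objD(1)[OF fD(1)] and w = inv_objD(2)[OF fD(1)] and z = inv_objD(2)[OF pD(1)]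
      and x = inv_objD(2)[OF fD(2)] and y = inv_objD(2)[OF gD(2)]
    obtain h where h: "h \<in> hom C (fst W) (fst Z)" and ph: "p \<cdot>\<^bsub>C\<^esub> h = f" and qh: "q \<cdot>\<^bsub>C\<^esub> h = g"
      and uniq: "\<And>h'. h' \<in> hom C (fst W) (fst Z) \<Longrightarrow> p \<cdot>\<^bsub>C\<^esub> h' = f \<Longrightarrow> q \<cdot>\<^bsub>C\<^esub> h' = g \<Longrightarrow> h' = h"
      using P W fD(3) gD(3) unfolding is_product_def by metis
    have "equivariant C W Z h"
    proof (rule equivariantI)
      fix k
      have 1: "p \<cdot>\<^bsub>C\<^esub> snd Z k \<cdot>\<^bsub>C\<^esub> h = p \<cdot>\<^bsub>C\<^esub> h \<cdot>\<^bsub>C\<^esub> snd W k"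
        using comp_assoc[OF h z pD(3)] comp_assoc[OF h pD(3) x] comp_assoc[OF w h pD(3)]
          pD(4) fD(4) ph by metis
      have 2: "q \<cdot>\<^bsub>C\<^esub> snd Z k \<cdot>\<^bsub>C\<^esub> h = q \<cdot>\<^bsub>C\<^esub> h \<cdot>\<^bsub>C\<^esub> snd W k"
        using comp_assoc[OF h z qD(3)] comp_assoc[OF h qD(3) y] comp_assoc[OF w h qD(3)]
          qD(4) gD(4) qh by metis
      show "snd Z k \<cdot>\<^bsub>C\<^esub> h = h \<cdot>\<^bsub>C\<^esub> snd W k"
        by (rule is_product_ext[OF P W comp_hom[OF h z] comp_hom[OF w h] 1 2])
          (rule comp_hom[OF comp_hom[OF w h] pD(3)] comp_hom[OF comp_hom[OF w h] qD(3)])+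
    qed (use fD pD h in auto)
    then have "(W, h, Z) \<in> hom (Inv C) W Z"
      by (simp add: hom_Inv_triple[OF assms(1)])
    moreover have "u = (W, h, Z)"
      if "u \<in> hom (Inv C) W Z" "(Z, p, X) \<cdot>\<^bsub>Inv C\<^esub> u = (W, f, X)" "(Z, q, Y) \<cdot>\<^bsub>Inv C\<^esub> u = (W, g, Y)" for u
    proof -
      obtain h' where "u = (W, h', Z)" "equivariant C W Z h'"
        using \<open>u \<in> hom (Inv C) W Z\<close> by (auto simp only: hom_Inv[OF assms(1)])
      then show ?thesis using that(2,3) uniq[OF equivariantD(3)] by simp
    qed
    ultimately show ?thesis
      using ph qh Inv_simps(6) by metis
  qed
  have "\<exists>!u. u \<in> hom (Inv C) W Z \<and> (Z, p, X) \<cdot>\<^bsub>Inv C\<^esub> u = v \<and> (Z, q, Y) \<cdot>\<^bsub>Inv C\<^esub> u = w"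
    if vw: "v \<in> hom (Inv C) W X" "w \<in> hom (Inv C) W Y" for W v w
  proof -
    obtain f g where v: "v = (W, f, X)" and w: "w = (W, g, Y)"
      and f: "equivariant C W X f" and g: "equivariant C W Y g"
      using vw by (auto simp only: hom_Inv[OF assms(1)])
    show ?thesis unfolding v w by (rule mediating[OF f g])
  qed
  then show ?thesis
    using p q pD(1) by (simp add: is_product_def hom_Inv_triple[OF assms(1)])
qed

lemma has_binary_products_Inv:
  assumes "category C" and "has_binary_products C"
  shows "has_binary_products (Inv C)"
proof -
  interpret category C by fact
  have "\<exists>Z p q. is_product (Inv C) X Y Z p q" if X: "X \<in> inv_obj C" and Y: "Y \<in> inv_obj C" for X Y
  proof -
    note x = inv_objD[OF X] and y = inv_objD[OF Y]
    obtain P p q where P: "is_product C (fst X) (fst Y) P p q"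
      using assms(2) x(1) y(1) unfolding has_binary_products_def by blast
    then have PO: "P \<in> Obj C" and p: "p \<in> hom C P (fst X)" and q: "q \<in> hom C P (fst Y)"
      by (auto simp: is_product_def)
    \<comment> \<open>The involution on \<open>P\<close> acts factorwise: it is the mediating arrow
      of the cone \<open>snd X k \<cdot> p\<close>, \<open>snd Y k \<cdot> q\<close>.\<close>
    have "\<exists>r. r \<in> hom C P P \<and> p \<cdot>\<^bsub>C\<^esub> r = snd X k \<cdot>\<^bsub>C\<^esub> p \<and> q \<cdot>\<^bsub>C\<^esub> r = snd Y k \<cdot>\<^bsub>C\<^esub> q" for k
      using P PO comp_hom[OF p x(2)] comp_hom[OF q y(2)] unfolding is_product_def by meson
    then obtain r where r: "\<And>k. r k \<in> hom C P P" and pr: "\<And>k. p \<cdot>\<^bsub>C\<^esub> r k = snd X k \<cdot>\<^bsub>C\<^esub> p"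
      and qr: "\<And>k. q \<cdot>\<^bsub>C\<^esub> r k = snd Y k \<cdot>\<^bsub>C\<^esub> q"
      by metis
    have Z: "(P, r) \<in> inv_obj C"
    proof (rule inv_objI)
      fix k
      \<comment> \<open>Seen through a projection, \<open>r k\<close> applied twice is the
        involution of that factor applied twice, so it projects like the identity of
        \<open>P\<close>.\<close>
      have 1: "p \<cdot>\<^bsub>C\<^esub> r k \<cdot>\<^bsub>C\<^esub> r k = p \<cdot>\<^bsub>C\<^esub> Idn C P"
        using comp_assoc[OF r r p] comp_assoc[OF r p x(2)] comp_assoc[OF p x(2) x(2)]
          pr x(3) idn_comp[OF p] comp_idn[OF p] by metis
      have 2: "q \<cdot>\<^bsub>C\<^esub> r k \<cdot>\<^bsub>C\<^esub> r k = q \<cdot>\<^bsub>C\<^esub> Idn C P"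
        using comp_assoc[OF r r q] comp_assoc[OF r q y(2)] comp_assoc[OF q y(2) y(2)]
          qr y(3) idn_comp[OF q] comp_idn[OF q] by metis
      show "r k \<cdot>\<^bsub>C\<^esub> r k = Idn C P"
        by (rule is_product_ext[OF P PO comp_hom[OF r r] idn_hom[OF PO] 1 2])
          (simp_all add: comp_idn[OF p] comp_idn[OF q] p q)
    qed (use PO r in auto)
    have "equivariant C (P, r) X p" "equivariant C (P, r) Y q"
      using Z X Y p q pr qr by (auto intro!: equivariantI)
    then show ?thesis
      using is_product_Inv[OF assms(1), of X Y "(P, r)" p q] P unfolding fst_conv by blast
  qed
  then show ?thesis
    by (simp add: has_binary_products_def)
qed


section \<open>The symmetric monoidal structure\<close>

context symmetric_monoidal_category
begin

lemma inv_tens_obj: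
  assumes X: "X \<in> inv_obj C" and Y: "Y \<in> inv_obj C"
  shows "inv_tens C X Y \<in> inv_obj C"
proof -
  note x = inv_objD[OF X] and y = inv_objD[OF Y]
  have "(fst X \<otimes> fst Y, \<lambda>k. snd X k \<otimes>\<^sub>a snd Y k) \<in> inv_obj C"
    using x y
    by (intro inv_objI)
      (simp_all add: tens_obj tensa_hom tensa_idn tensa_comp[OF x(2) x(2) y(2) y(2), symmetric])
  then show ?thesis by (simp add: inv_tens_def case_prod_beta)
qed

lemma inv_unit_obj: "inv_unit C \<in> inv_obj C"
  unfolding inv_unit_def using unit_obj
  by (intro inv_objI) (auto simp: idn_hom comp_idn[OF idn_hom])

lemma equivariant_tensa:
  assumes f: "equivariant C X X' f" and g: "equivariant C Y Y' g"
  shows "equivariant C (inv_tens C X Y) (inv_tens C X' Y') (f \<otimes>\<^sub>a g)"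
proof (rule equivariantI)
  note fD = equivariantD[OF f] and gD = equivariantD[OF g]
  note s = inv_objD(2)[OF fD(1)] inv_objD(2)[OF fD(2)] inv_objD(2)[OF gD(1)] inv_objD(2)[OF gD(2)]
  fix k
  show "snd (inv_tens C X' Y') k \<cdot> (f \<otimes>\<^sub>a g) = (f \<otimes>\<^sub>a g) \<cdot> snd (inv_tens C X Y) k"
    using tensa_comp[OF fD(3) s(2) gD(3) s(4)] tensa_comp[OF s(1) fD(3) s(3) gD(3)] fD(4) gD(4)
    by simp
qed (use f g in \<open>simp_all add: equivariant_def inv_tens_obj tensa_hom\<close>)

text \<open>Naturality of the associator, taken at the involutions, is literally the equivariance
  condition; the unitors and the symmetry below are treated alike.\<close>

lemma equivariant_assoc:
  assumes "X \<in> inv_obj C" "Y \<in> inv_obj C" "Z \<in> inv_obj C"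
  shows "equivariant C (inv_tens C (inv_tens C X Y) Z) (inv_tens C X (inv_tens C Y Z))
    (Assoc C (fst X) (fst Y) (fst Z))"
  using assms
  by (intro equivariantI)
    (simp_all add: inv_tens_obj assoc_hom inv_objD(1) assoc_nat[OF inv_objD(2) inv_objD(2) inv_objD(2)])

lemma equivariant_lunit:
  "X \<in> inv_obj C \<Longrightarrow> equivariant C (inv_tens C (inv_unit C) X) X (Lunit C (fst X))"
  by (intro equivariantI)
    (simp_all add: inv_tens_obj inv_unit_obj lunit_hom inv_objD(1) lunit_nat[OF inv_objD(2)])

lemma equivariant_runit:
  "X \<in> inv_obj C \<Longrightarrow> equivariant C (inv_tens C X (inv_unit C)) X (Runit C (fst X))"
  by (intro equivariantI)
    (simp_all add: inv_tens_obj inv_unit_obj runit_hom inv_objD(1) runit_nat[OF inv_objD(2)])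

lemma equivariant_sym:
  assumes "X \<in> inv_obj C" "Y \<in> inv_obj C"
  shows "equivariant C (inv_tens C X Y) (inv_tens C Y X) (Sym C (fst X) (fst Y))"
  using assms
  by (intro equivariantI)
    (simp_all add: inv_tens_obj sym_hom inv_objD(1) sym_nat[OF inv_objD(2) inv_objD(2)])

end

text \<open>Parallel arrows of \<open>Inv C\<close> are equal as soon as their middle components
  are, so the coherence and naturality equations are those of \<open>C\<close>. Only the typing of
  the structural arrows needs the equivariance lemmas.\<close>

lemma symmetric_monoidal_category_Inv:
  assumes "symmetric_monoidal_category C"
  shows "symmetric_monoidal_category (Inv C)"
proof -
  interpret symmetric_monoidal_category C by fact
  have cat: "category C" by unfold_locales
  interpret I: category "Inv C" by (rule category_Inv[OF cat])
  note hom = hom_Inv[OF cat] hom_Inv_triple[OF cat] 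
  note eD = equivariantD(3)
  show ?thesis
  proof (unfold_locales, goal_cases)
    case 1 then show ?case by (simp add: inv_tens_obj)
  next
    case 2 then show ?case by (auto simp: hom equivariant_tensa)
  next
    case 3 then show ?case by (simp add: tensa_idn inv_objD)
  next
    case 4 then show ?case by (auto simp: hom tensa_comp[OF eD eD eD eD])
  next
    case 5 then show ?case by (simp add: inv_unit_obj)
  next
    case 6 then show ?case by (simp add: hom equivariant_assoc)
  next
    case 7 then show ?case by (simp add: is_iso_Inv[OF cat] equivariant_assoc assoc_iso inv_objD)
  next
    case 8 then show ?case by (auto simp: hom assoc_nat[OF eD eD eD])
  next
    case 9 then show ?case by (simp add: hom equivariant_lunit)
  next
    case 10 then show ?case by (simp add: is_iso_Inv[OF cat] equivariant_lunit lunit_iso inv_objD)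
  next
    case 11 then show ?case by (auto simp: hom lunit_nat[OF eD])
  next
    case 12 then show ?case by (simp add: hom equivariant_runit)
  next
    case 13 then show ?case by (simp add: is_iso_Inv[OF cat] equivariant_runit runit_iso inv_objD)
  next
    case 14 then show ?case by (auto simp: hom runit_nat[OF eD])
  next
    case 15 then show ?case by (simp add: hom equivariant_sym)
  next
    case 16 then show ?case by (auto simp: hom sym_nat[OF eD eD])
  next
    case 17 then show ?case by (simp add: sym_sym inv_objD)
  next
    case 18 then show ?case by (simp add: pentagon inv_objD)
  next
    case 19 then show ?case by (simp add: triangle inv_objD)
  next
    case 20 then show ?case by (simp add: hexagon inv_objD)
  qed
qed

text \<open>The projections of \<open>C\<close> are natural, hence equivariant for the tensored
  involutions. By \<open>is_product_Inv\<close> the lifted tensor is then a product, and the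
  remaining equations hold on middle components.\<close>

lemma cartesian_category_Inv:
  assumes "cartesian_category C pr1 pr2"
  shows "cartesian_category (Inv C)
    (\<lambda>X Y. (inv_tens C X Y, pr1 (fst X) (fst Y), X))
    (\<lambda>X Y. (inv_tens C X Y, pr2 (fst X) (fst Y), Y))"
proof -
  interpret cartesian_category C pr1 pr2 by fact
  have cat: "category C" by unfold_locales
  interpret I: symmetric_monoidal_category "Inv C"
    by (rule symmetric_monoidal_category_Inv) unfold_locales
  note hom = hom_Inv[OF cat]
  note eD = equivariantD(3)
  have pr1: "equivariant C (inv_tens C X Y) X (pr1 (fst X) (fst Y))"
    and pr2: "equivariant C (inv_tens C X Y) Y (pr2 (fst X) (fst Y))"
    if "X \<in> inv_obj C" "Y \<in> inv_obj C" for X Y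
    using that tens_product[of "fst X" "fst Y"]
    by (auto intro!: equivariantI simp: inv_tens_obj inv_objD(1) is_product_def
        pr1_tensa[OF inv_objD(2) inv_objD(2)] pr2_tensa[OF inv_objD(2) inv_objD(2)])
  show ?thesis
  proof (unfold_locales, goal_cases)
    case 1 then show ?case
      using is_terminal_Inv[OF cat unit_terminal] by (simp add: inv_unit_def)
  next
    case (2 X Y) then show ?case
      using is_product_Inv[OF cat, of X Y "inv_tens C X Y"] pr1 pr2
      by (simp add: tens_product inv_objD(1))
  next
    case 3 then show ?case by (auto simp: hom pr1_tensa[OF eD eD])
  next
    case 4 then show ?case by (auto simp: hom pr2_tensa[OF eD eD])
  qed (simp_all add: inv_objD(1) pr1_assoc pr1_pr2_assoc pr2_pr2_assoc lunit_pr2 runit_pr1 pr1_sym pr2_sym)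
qed


section \<open>Internal homs and dualisation\<close>

context symmetric_monoidal_closed_category
begin

lemma curry_spec:
  assumes "X \<in> Obj C" "A \<in> Obj C" "B \<in> Obj C" "f \<in> hom C (X \<otimes> A) B"
  shows "curry X A B f \<in> hom C X (ihom A B)" "ev A B \<cdot> (curry X A B f \<otimes>\<^sub>a Idn C A) = f"
  using theI'[OF ev_universal[OF assms]] by (simp_all add: curry_def)

lemma curry_unique:
  assumes "X \<in> Obj C" "A \<in> Obj C" "B \<in> Obj C" "f \<in> hom C (X \<otimes> A) B"
    and "g \<in> hom C X (ihom A B)" "ev A B \<cdot> (g \<otimes>\<^sub>a Idn C A) = f"
  shows "curry X A B f = g"
  unfolding curry_def using the1_equality[OF ev_universal[OF assms(1-4)]] assms(5,6) by simp

text \<open>Both arrows are the \<open>curry\<close> of the same arrow. This is the extensionality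
  principle used below for equations between arrows into an internal hom.\<close>

lemma ev_ext:
  assumes "X \<in> Obj C" "A \<in> Obj C" "B \<in> Obj C"
    and "g \<in> hom C X (ihom A B)" "h \<in> hom C X (ihom A B)"
    and "ev A B \<cdot> (g \<otimes>\<^sub>a Idn C A) = ev A B \<cdot> (h \<otimes>\<^sub>a Idn C A)"
  shows "g = h"
proof -
  have "ev A B \<cdot> (h \<otimes>\<^sub>a Idn C A) \<in> hom C (X \<otimes> A) B"
    using assms by (intro comp_hom[OF tensa_hom ev_hom]) (auto intro: idn_hom)
  then show ?thesis
    using curry_unique[of X A B "ev A B \<cdot> (h \<otimes>\<^sub>a Idn C A)"] assms by metis
qed

text \<open>Conjugation by the involutions, \<open>g \<mapsto> t k \<cdot> g \<cdot> s k\<close>, internalised.\<close>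

definition inv_ihom :: "('o, 'a) iobj \<Rightarrow> ('o, 'a) iobj \<Rightarrow> ('o, 'a) iobj" where
  "inv_ihom X Y =
     (ihom (fst X) (fst Y),
      \<lambda>k. curry (ihom (fst X) (fst Y)) (fst X) (fst Y)
            (snd Y k \<cdot> ev (fst X) (fst Y) \<cdot> (Idn C (ihom (fst X) (fst Y)) \<otimes>\<^sub>a snd X k)))"

definition inv_ev :: "('o, 'a) iobj \<Rightarrow> ('o, 'a) iobj \<Rightarrow> ('o, 'a) iarr" where
  "inv_ev X Y = (inv_tens C (inv_ihom X Y) X, ev (fst X) (fst Y), Y)"

lemma fst_inv_ihom [simp]: "fst (inv_ihom X Y) = ihom (fst X) (fst Y)"
  by (simp add: inv_ihom_def)

context
  fixes X Y
  assumes X: "X \<in> inv_obj C" and Y: "Y \<in> inv_obj C"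
begin

private abbreviation (input) H where "H \<equiv> ihom (fst X) (fst Y)"
private abbreviation (input) e where "e \<equiv> ev (fst X) (fst Y)"

lemma ihom_involution:
  "snd (inv_ihom X Y) k \<in> hom C H H"
  "e \<cdot> (snd (inv_ihom X Y) k \<otimes>\<^sub>a Idn C (fst X)) = snd Y k \<cdot> e \<cdot> (Idn C H \<otimes>\<^sub>a snd X k)"
proof -
  note x = inv_objD[OF X] and y = inv_objD[OF Y]
  have H: "H \<in> Obj C" using ihom_obj[OF x(1) y(1)] .
  have "snd Y k \<cdot> e \<cdot> (Idn C H \<otimes>\<^sub>a snd X k) \<in> hom C (H \<otimes> fst X) (fst Y)"
    using comp_hom[OF comp_hom[OF tensa_hom[OF idn_hom[OF H] x(2)] ev_hom[OF x(1) y(1)]] y(2)] .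
  from curry_spec[OF H x(1) y(1) this]
  show "snd (inv_ihom X Y) k \<in> hom C H H"
    "e \<cdot> (snd (inv_ihom X Y) k \<otimes>\<^sub>a Idn C (fst X)) = snd Y k \<cdot> e \<cdot> (Idn C H \<otimes>\<^sub>a snd X k)"
    by (simp_all add: inv_ihom_def)
qed

text \<open>The uncurried effect of composing with the involution of the internal hom: the tensor
  splits off \<open>g\<close>, the defining equation of the involution applies, and \<open>g\<close>
  is merged with \<open>snd X k\<close> by the interchange law.\<close>

lemma ev_involution_comp:
  assumes g: "g \<in> hom C A H"
  shows "e \<cdot> ((snd (inv_ihom X Y) k \<cdot> g) \<otimes>\<^sub>a Idn C (fst X)) = snd Y k \<cdot> e \<cdot> (g \<otimes>\<^sub>a snd X k)"
proof -
  note x = inv_objD[OF X] and y = inv_objD[OF Y] and r = ihom_involution(1)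
  have H: "H \<in> Obj C" using ihom_obj[OF x(1) y(1)] .
  note i = idn_hom[OF x(1)] and e = ev_hom[OF x(1) y(1)] and j = idn_hom[OF H]
  have "e \<cdot> ((snd (inv_ihom X Y) k \<cdot> g) \<otimes>\<^sub>a Idn C (fst X))
      = e \<cdot> (snd (inv_ihom X Y) k \<otimes>\<^sub>a Idn C (fst X)) \<cdot> (g \<otimes>\<^sub>a Idn C (fst X))"
    using tensa_comp[OF g r i i] comp_idn[OF i] by simp
  also have "\<dots> = (snd Y k \<cdot> e \<cdot> (Idn C H \<otimes>\<^sub>a snd X k)) \<cdot> (g \<otimes>\<^sub>a Idn C (fst X))"
    using comp_assoc[OF tensa_hom[OF g i] tensa_hom[OF r i] e] ihom_involution(2) by simp
  also have "\<dots> = snd Y k \<cdot> e \<cdot> (Idn C H \<otimes>\<^sub>a snd X k) \<cdot> (g \<otimes>\<^sub>a Idn C (fst X))"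
    using comp_assoc[OF tensa_hom[OF g i] comp_hom[OF tensa_hom[OF j x(2)] e] y(2)]
      comp_assoc[OF tensa_hom[OF g i] tensa_hom[OF j x(2)] e] by simp
  also have "\<dots> = snd Y k \<cdot> e \<cdot> (g \<otimes>\<^sub>a snd X k)"
    using tensa_comp[OF g j i x(2)] idn_comp[OF g] comp_idn[OF x(2)] by simp
  finally show ?thesis .
qed

text \<open>Under evaluation, applying the involution twice conjugates twice, so the involutions of
  \<open>X\<close> and of \<open>Y\<close> cancel in pairs; \<open>ev_ext\<close> transfers this to
  the internal hom.\<close>

lemma inv_ihom_obj: "inv_ihom X Y \<in> inv_obj C"
proof -
  note x = inv_objD[OF X] and y = inv_objD[OF Y] and r = ihom_involution(1)
  have H: "H \<in> Obj C" using ihom_obj[OF x(1) y(1)] .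
  note i = idn_hom[OF x(1)] and e = ev_hom[OF x(1) y(1)] and j = idn_hom[OF H]
  have "snd (inv_ihom X Y) k \<cdot> snd (inv_ihom X Y) k = Idn C H" for k
  proof (rule ev_ext[OF H x(1) y(1) comp_hom[OF r r] j])
    let ?r = "snd (inv_ihom X Y) k"
    \<comment> \<open>\<open>ev_involution_comp\<close> is used with \<open>g\<close> equal to
      \<open>?r\<close> itself; interchange then separates \<open>?r\<close> from
      \<open>snd X k\<close>, so that the inner evaluation can be rewritten too.\<close>
    have "e \<cdot> ((?r \<cdot> ?r) \<otimes>\<^sub>a Idn C (fst X)) = snd Y k \<cdot> e \<cdot> (?r \<otimes>\<^sub>a Idn C (fst X)) \<cdot> (Idn C H \<otimes>\<^sub>a snd X k)"
      using ev_involution_comp[OF r] tensa_comp[OF j r x(2) i] comp_idn[OF r] idn_comp[OF x(2)]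
      by simp
    also have "\<dots> = snd Y k \<cdot> (snd Y k \<cdot> e \<cdot> (Idn C H \<otimes>\<^sub>a snd X k)) \<cdot> (Idn C H \<otimes>\<^sub>a snd X k)"
      using comp_assoc[OF tensa_hom[OF j x(2)] tensa_hom[OF r i] e] ihom_involution(2) by simp
    also have "\<dots> = snd Y k \<cdot> snd Y k \<cdot> e \<cdot> (Idn C H \<otimes>\<^sub>a snd X k) \<cdot> (Idn C H \<otimes>\<^sub>a snd X k)"
      using comp_assoc[OF tensa_hom[OF j x(2)] comp_hom[OF tensa_hom[OF j x(2)] e] y(2)]
        comp_assoc[OF tensa_hom[OF j x(2)] tensa_hom[OF j x(2)] e] by simp
    also have "\<dots> = snd Y k \<cdot> snd Y k \<cdot> e \<cdot> (Idn C H \<otimes>\<^sub>a Idn C (fst X))"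
      by (simp add: tensa_comp[OF j j x(2) x(2), symmetric] comp_idn[OF j] x(3))
    also have "\<dots> = (snd Y k \<cdot> snd Y k) \<cdot> e \<cdot> (Idn C H \<otimes>\<^sub>a Idn C (fst X))"
      using comp_assoc[OF comp_hom[OF tensa_hom[OF j i] e] y(2) y(2)] by simp
    also have "\<dots> = e \<cdot> (Idn C H \<otimes>\<^sub>a Idn C (fst X))"
      using idn_comp[OF comp_hom[OF tensa_hom[OF j i] e]] y(3) by simp
    finally show "e \<cdot> ((?r \<cdot> ?r) \<otimes>\<^sub>a Idn C (fst X)) = e \<cdot> (Idn C H \<otimes>\<^sub>a Idn C (fst X))" .
  qed
  then have "(H, snd (inv_ihom X Y)) \<in> inv_obj C"
    using H r by (intro inv_objI) auto
  then show ?thesis by (simp add: inv_ihom_def)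
qed

text \<open>Split the tensored involution into its part on the internal hom and its part on
  \<open>X\<close>. The first conjugates the evaluation and so brings in a second copy of
  \<open>snd X k\<close>, which cancels the one already there.\<close>

lemma equivariant_ev: "equivariant C (inv_tens C (inv_ihom X Y) X) Y e"
proof (rule equivariantI)
  note x = inv_objD[OF X] and y = inv_objD[OF Y] and r = ihom_involution(1)
  have H: "H \<in> Obj C" using ihom_obj[OF x(1) y(1)] .
  note i = idn_hom[OF x(1)] and e = ev_hom[OF x(1) y(1)] and j = idn_hom[OF H]
  fix k
  let ?r = "snd (inv_ihom X Y) k"
  have "e \<cdot> (?r \<otimes>\<^sub>a snd X k) = e \<cdot> (?r \<otimes>\<^sub>a Idn C (fst X)) \<cdot> (Idn C H \<otimes>\<^sub>a snd X k)"
    using tensa_comp[OF j r x(2) i] comp_idn[OF r] idn_comp[OF x(2)] by simp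
  also have "\<dots> = (snd Y k \<cdot> e \<cdot> (Idn C H \<otimes>\<^sub>a snd X k)) \<cdot> (Idn C H \<otimes>\<^sub>a snd X k)"
    using comp_assoc[OF tensa_hom[OF j x(2)] tensa_hom[OF r i] e] ihom_involution(2) by simp
  also have "\<dots> = snd Y k \<cdot> e \<cdot> (Idn C H \<otimes>\<^sub>a snd X k) \<cdot> (Idn C H \<otimes>\<^sub>a snd X k)"
    using comp_assoc[OF tensa_hom[OF j x(2)] comp_hom[OF tensa_hom[OF j x(2)] e] y(2)]
      comp_assoc[OF tensa_hom[OF j x(2)] tensa_hom[OF j x(2)] e] by simp
  also have "\<dots> = snd Y k \<cdot> e"
    by (simp add: tensa_comp[OF j j x(2) x(2), symmetric] comp_idn[OF j] x(1,3) H comp_idn[OF e] tensa_idn)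
  finally show "snd Y k \<cdot> e = e \<cdot> snd (inv_tens C (inv_ihom X Y) X) k" by simp
qed (simp_all add: X Y inv_tens_obj inv_ihom_obj ev_hom inv_objD(1))

text \<open>By \<open>ev_ext\<close> the uncurried sides are compared. The left one is
  \<open>snd Y k \<cdot> f\<close> preceded by \<open>snd X k\<close> on the second factor;
  equivariance of \<open>f\<close> trades \<open>snd Y k\<close> for the involutions of
  \<open>Z\<close> and \<open>X\<close>, and the two copies of \<open>snd X k\<close>
  cancel.\<close>

lemma equivariant_curry:
  assumes Z: "Z \<in> inv_obj C" and f: "equivariant C (inv_tens C Z X) Y f"
  shows "equivariant C Z (inv_ihom X Y) (curry (fst Z) (fst X) (fst Y) f)"
proof (rule equivariantI)
  note x = inv_objD[OF X] and y = inv_objD[OF Y] and z = inv_objD[OF Z] and r = ihom_involution(1)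
  have H: "H \<in> Obj C" using ihom_obj[OF x(1) y(1)] .
  note i = idn_hom[OF x(1)] and e = ev_hom[OF x(1) y(1)] and j = idn_hom[OF H]
  have f': "f \<in> hom C (fst Z \<otimes> fst X) (fst Y)" using equivariantD(3)[OF f] by simp
  let ?g = "curry (fst Z) (fst X) (fst Y) f"
  have g: "?g \<in> hom C (fst Z) H" and eg: "e \<cdot> (?g \<otimes>\<^sub>a Idn C (fst X)) = f"
    using curry_spec[OF z(1) x(1) y(1) f'] by auto
  show "?g \<in> hom C (fst Z) (fst (inv_ihom X Y))" using g by simp
  note iz = idn_hom[OF z(1)]
  fix k
  show "snd (inv_ihom X Y) k \<cdot> ?g = ?g \<cdot> snd Z k"
  proof (rule ev_ext[OF z(1) x(1) y(1) comp_hom[OF g r] comp_hom[OF z(2) g]])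
    have "e \<cdot> ((snd (inv_ihom X Y) k \<cdot> ?g) \<otimes>\<^sub>a Idn C (fst X))
        = snd Y k \<cdot> e \<cdot> (?g \<otimes>\<^sub>a Idn C (fst X)) \<cdot> (Idn C (fst Z) \<otimes>\<^sub>a snd X k)"
      using ev_involution_comp[OF g] tensa_comp[OF iz g x(2) i] comp_idn[OF g] idn_comp[OF x(2)]
      by simp
    also have "\<dots> = snd Y k \<cdot> f \<cdot> (Idn C (fst Z) \<otimes>\<^sub>a snd X k)"
      using comp_assoc[OF tensa_hom[OF iz x(2)] tensa_hom[OF g i] e] eg by simp
    also have "\<dots> = (f \<cdot> (snd Z k \<otimes>\<^sub>a snd X k)) \<cdot> (Idn C (fst Z) \<otimes>\<^sub>a snd X k)"
      using comp_assoc[OF tensa_hom[OF iz x(2)] f' y(2), of k k, symmetric] equivariantD(4)[OF f, of k]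
      by simp
    also have "\<dots> = f \<cdot> (snd Z k \<otimes>\<^sub>a Idn C (fst X))"
      by (simp add: comp_assoc[OF tensa_hom[OF iz x(2)] tensa_hom[OF z(2) x(2)] f']
        tensa_comp[OF iz z(2) x(2) x(2), symmetric] comp_idn[OF z(2)] x(3))
    also have "\<dots> = e \<cdot> (?g \<otimes>\<^sub>a Idn C (fst X)) \<cdot> (snd Z k \<otimes>\<^sub>a Idn C (fst X))"
      using comp_assoc[OF tensa_hom[OF z(2) i] tensa_hom[OF g i] e] eg by simp
    also have "\<dots> = e \<cdot> ((?g \<cdot> snd Z k) \<otimes>\<^sub>a Idn C (fst X))"
      using tensa_comp[OF z(2) g i i] comp_idn[OF i] by simp
    finally show "e \<cdot> ((snd (inv_ihom X Y) k \<cdot> ?g) \<otimes>\<^sub>a Idn C (fst X))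
        = e \<cdot> ((?g \<cdot> snd Z k) \<otimes>\<^sub>a Idn C (fst X))" .
  qed
qed (use Z inv_ihom_obj in auto)

end

end

text \<open>Transposition in \<open>Inv C\<close> is transposition in \<open>C\<close>:
  \<open>equivariant_curry\<close> makes the transpose an arrow of \<open>Inv C\<close>, and
  \<open>curry_unique\<close> gives uniqueness on middle components.\<close>

lemma symmetric_monoidal_closed_category_Inv:
  assumes "symmetric_monoidal_closed_category C ihom ev"
  shows "symmetric_monoidal_closed_category (Inv C)
    (symmetric_monoidal_closed_category.inv_ihom C ihom ev)
    (symmetric_monoidal_closed_category.inv_ev C ihom ev)"
proof -
  interpret symmetric_monoidal_closed_category C ihom ev by fact
  have cat: "category C" by unfold_locales
  interpret I: symmetric_monoidal_category "Inv C"
    by (rule symmetric_monoidal_category_Inv) unfold_locales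
  show ?thesis
  proof (unfold_locales, goal_cases)
    case 1 then show ?case by (simp add: inv_ihom_obj)
  next
    case 2 then show ?case by (simp add: inv_ev_def hom_Inv_triple[OF cat] equivariant_ev)
  next
    case (3 Z X Y u)
    then have Z: "Z \<in> inv_obj C" and X: "X \<in> inv_obj C" and Y: "Y \<in> inv_obj C" by auto
    obtain f where u: "u = (inv_tens C Z X, f, Y)" and f: "equivariant C (inv_tens C Z X) Y f"
      using 3(4) by (auto simp: hom_Inv[OF cat])
    note objs = inv_objD(1)[OF Z] inv_objD(1)[OF X] inv_objD(1)[OF Y]
    have f': "f \<in> hom C (fst Z \<otimes>\<^bsub>C\<^esub> fst X) (fst Y)" using equivariantD(3)[OF f] by simp
    show ?case
    proof (rule ex1I[of _ "(Z, curry (fst Z) (fst X) (fst Y) f, inv_ihom X Y)"])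
      show "(Z, curry (fst Z) (fst X) (fst Y) f, inv_ihom X Y) \<in> hom (Inv C) Z (inv_ihom X Y) \<and>
        inv_ev X Y \<cdot>\<^bsub>Inv C\<^esub> ((Z, curry (fst Z) (fst X) (fst Y) f, inv_ihom X Y) \<otimes>\<^sub>a\<^bsub>Inv C\<^esub> Idn (Inv C) X) = u"
        using equivariant_curry[OF X Y Z f] curry_spec(2)[OF objs f']
        by (simp add: hom_Inv_triple[OF cat] inv_ev_def u)
    next
      fix v
      assume v: "v \<in> hom (Inv C) Z (inv_ihom X Y) \<and> inv_ev X Y \<cdot>\<^bsub>Inv C\<^esub> (v \<otimes>\<^sub>a\<^bsub>Inv C\<^esub> Idn (Inv C) X) = u"
      then obtain g where "v = (Z, g, inv_ihom X Y)" "equivariant C Z (inv_ihom X Y) g"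
        by (auto simp: hom_Inv[OF cat])
      then show "v = (Z, curry (fst Z) (fst X) (fst Y) f, inv_ihom X Y)"
        using v curry_unique[OF objs f', of g] by (auto simp: inv_ev_def u dest: equivariantD(3))
    qed
  qed
qed

text \<open>With identity involutions on the dualising object, the canonical arrow into the double
  dual in \<open>Inv C\<close> lies over the one in \<open>C\<close>, and the invertibility of the
  latter lifts by \<open>is_iso_Inv\<close>.\<close>

lemma star_autonomous_category_Inv:
  fixes C :: "('o, 'a) smc" and bot :: 'o
  assumes "star_autonomous_category C ihom ev bot"
  shows "star_autonomous_category (Inv C)
    (symmetric_monoidal_closed_category.inv_ihom C ihom ev)
    (symmetric_monoidal_closed_category.inv_ev C ihom ev) (bot, \<lambda>k. Idn C bot)"
proof -
  interpret star_autonomous_category C ihom ev bot by fact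
  have cat: "category C" by unfold_locales
  interpret I: symmetric_monoidal_closed_category "Inv C" inv_ihom inv_ev
    by (rule symmetric_monoidal_closed_category_Inv) unfold_locales
  let ?Z = "(bot, \<lambda>k::int. Idn C bot)"
  have Z: "?Z \<in> inv_obj C"
    using bot_obj by (intro inv_objI) (auto simp: idn_hom comp_idn[OF idn_hom])
  show ?thesis
  proof (unfold_locales, goal_cases)
    case 1 then show ?case using Z by simp
  next
    case (2 X)
    then have X: "X \<in> inv_obj C" by simp
    let ?H = "inv_ihom X ?Z"
    have H: "?H \<in> inv_obj C" using inv_ihom_obj[OF X Z] .
    \<comment> \<open>Evaluation with its arguments exchanged; its transpose is the canonical arrow
      into the double dual.\<close>
    let ?f = "ev (fst X) bot \<cdot>\<^bsub>C\<^esub> Sym C (fst X) (fst ?H)"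
    have f: "equivariant C (inv_tens C X ?H) ?Z ?f"
      using equivariant_comp[OF equivariant_sym[OF X H] equivariant_ev[OF X Z]] by simp
    have f': "?f \<in> hom C (fst X \<otimes>\<^bsub>C\<^esub> fst ?H) bot" using equivariantD(3)[OF f] by simp
    have g: "equivariant C X (inv_ihom ?H ?Z) (bidual bot (fst X))"
      using equivariant_curry[OF H Z X f] by (simp add: bidual_def)
    \<comment> \<open>Uniqueness of transposes in \<open>Inv C\<close> identifies the two arrows
      without unfolding \<open>I.curry\<close>: the lifted arrow only has to satisfy the defining
      equation.\<close>
    have "I.bidual ?Z X = (X, bidual bot (fst X), inv_ihom ?H ?Z)"
      unfolding I.bidual_def
    proof (rule I.curry_unique)
      show "inv_ev X ?Z \<cdot>\<^bsub>Inv C\<^esub> Sym (Inv C) X ?H \<in> hom (Inv C) (X \<otimes>\<^bsub>Inv C\<^esub> ?H) ?Z"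
        using f by (simp add: inv_ev_def hom_Inv_triple[OF cat])
      show "(X, bidual bot (fst X), inv_ihom ?H ?Z) \<in> hom (Inv C) X (inv_ihom ?H ?Z)"
        using g by (simp add: hom_Inv_triple[OF cat])
      show "inv_ev ?H ?Z \<cdot>\<^bsub>Inv C\<^esub> ((X, bidual bot (fst X), inv_ihom ?H ?Z) \<otimes>\<^sub>a\<^bsub>Inv C\<^esub> Idn (Inv C) ?H)
          = inv_ev X ?Z \<cdot>\<^bsub>Inv C\<^esub> Sym (Inv C) X ?H"
        using curry_spec(2)[OF inv_objD(1)[OF X] inv_objD(1)[OF H] bot_obj f']
        by (simp add: inv_ev_def bidual_def)
    qed (use X H Z in simp_all)
    then show ?case
      using is_iso_Inv[OF cat g bidual_iso[OF inv_objD(1)[OF X]]] by simp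
  qed
qed


section \<open>Functors, transformations and adjunctions\<close>

definition inv_fobj :: "('o, 'a, 'p, 'b) smfunctor \<Rightarrow> ('o, 'a) iobj \<Rightarrow> ('p, 'b) iobj" where
  "inv_fobj F X = (FObj F (fst X), \<lambda>k. FArr F (snd X k))"

text \<open>Both categories are arguments because arrows carry their end objects, and those of
  \<open>FMult\<close> and \<open>FUnit\<close> are built from the tensors and units of
  \<open>C\<close> and \<open>D\<close>.\<close>

definition Inv_functor ::
    "('o, 'a) smc \<Rightarrow> ('p, 'b) smc \<Rightarrow> ('o, 'a, 'p, 'b) smfunctor \<Rightarrow>
     (('o, 'a) iobj, ('o, 'a) iarr, ('p, 'b) iobj, ('p, 'b) iarr) smfunctor" where
  "Inv_functor C D F =
     \<lparr> FObj = inv_fobj F,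
       FArr = (\<lambda>(X, f, Y). (inv_fobj F X, FArr F f, inv_fobj F Y)),
       FMult = (\<lambda>X Y. (inv_tens D (inv_fobj F X) (inv_fobj F Y), FMult F (fst X) (fst Y),
                        inv_fobj F (inv_tens C X Y))),
       FUnit = (inv_unit D, FUnit F, inv_fobj F (inv_unit C)) \<rparr>"

lemma Inv_functor_simps [simp]:
  "FObj (Inv_functor C D F) = inv_fobj F"
  "FArr (Inv_functor C D F) (X, f, Y) = (inv_fobj F X, FArr F f, inv_fobj F Y)"
  "FMult (Inv_functor C D F) X Y = (inv_tens D (inv_fobj F X) (inv_fobj F Y),
     FMult F (fst X) (fst Y), inv_fobj F (inv_tens C X Y))"
  "FUnit (Inv_functor C D F) = (inv_unit D, FUnit F, inv_fobj F (inv_unit C))"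
  by (simp_all add: Inv_functor_def)

lemma inv_fobj_sel [simp]:
  "fst (inv_fobj F X) = FObj F (fst X)"
  "snd (inv_fobj F X) k = FArr F (snd X k)"
  by (simp_all add: inv_fobj_def)

context symmetric_monoidal_functor
begin

lemma inv_fobj_obj:
  assumes X: "X \<in> inv_obj C"
  shows "inv_fobj F X \<in> inv_obj D"
proof -
  note x = inv_objD[OF X]
  show ?thesis
    unfolding inv_fobj_def
    using x
    by (intro inv_objI) (auto simp: fobj farr_idn farr_comp[OF x(2) x(2), symmetric] intro: farr_hom)
qed

lemma equivariant_farr:
  assumes f: "equivariant C X Y f"
  shows "equivariant D (inv_fobj F X) (inv_fobj F Y) (FArr F f)"
proof (rule equivariantI)
  note fD = equivariantD[OF f]
  fix k show "snd (inv_fobj F Y) k \<cdot>\<^bsub>D\<^esub> FArr F f = FArr F f \<cdot>\<^bsub>D\<^esub> snd (inv_fobj F X) k"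
    using farr_comp[OF fD(3) inv_objD(2)[OF fD(2)]] farr_comp[OF inv_objD(2)[OF fD(1)] fD(3)] fD(4)
    by simp
qed (use equivariantD[OF f] in \<open>auto simp: inv_fobj_obj intro: farr_hom\<close>)

text \<open>Equivariance is the naturality of \<open>FMult F\<close> at the involutions.\<close>

lemma equivariant_fmult:
  assumes "X \<in> inv_obj C" "Y \<in> inv_obj C"
  shows "equivariant D (inv_tens D (inv_fobj F X) (inv_fobj F Y)) (inv_fobj F (inv_tens C X Y))
    (FMult F (fst X) (fst Y))"
  using assms
  by (intro equivariantI)
    (simp_all add: source.inv_tens_obj target.inv_tens_obj inv_fobj_obj fmult_hom inv_objD(1)
      fmult_nat[OF inv_objD(2) inv_objD(2)])

text \<open>Since \<open>F\<close> preserves identities, the involutions on both sides are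
  identities, and the unit laws suffice.\<close>

lemma equivariant_funit: "equivariant D (inv_unit D) (inv_fobj F (inv_unit C)) (FUnit F)"
  by (intro equivariantI)
    (simp_all add: source.inv_unit_obj target.inv_unit_obj inv_fobj_obj funit_hom
      farr_idn source.unit_obj target.idn_comp[OF funit_hom] target.comp_idn[OF funit_hom])

end

lemma symmetric_monoidal_functor_Inv:
  assumes "symmetric_monoidal_functor C D F"
  shows "symmetric_monoidal_functor (Inv C) (Inv D) (Inv_functor C D F)"
proof -
  interpret symmetric_monoidal_functor C D F by fact
  have C: "category C" and D: "category D" by unfold_locales
  interpret IC: symmetric_monoidal_category "Inv C"
    by (rule symmetric_monoidal_category_Inv) unfold_locales
  interpret ID: symmetric_monoidal_category "Inv D"
    by (rule symmetric_monoidal_category_Inv) unfold_locales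
  note hom = hom_Inv[OF C] hom_Inv[OF D] hom_Inv_triple[OF C] hom_Inv_triple[OF D]
  note eD = equivariantD(3)
  show ?thesis
  proof (unfold_locales, goal_cases)
    case 1 then show ?case by (simp add: inv_fobj_obj)
  next
    case 2 then show ?case by (auto simp: hom equivariant_farr)
  next
    case 3 then show ?case by (simp add: farr_idn inv_objD)
  next
    case 4 then show ?case by (auto simp: hom farr_comp[OF eD eD])
  next
    case 5 then show ?case by (simp add: hom equivariant_fmult)
  next
    case 6 then show ?case by (auto simp: hom fmult_nat[OF eD eD])
  next
    case 7 then show ?case by (simp add: hom equivariant_funit)
  next
    case 8 then show ?case by (simp add: fmult_assoc inv_objD)
  next
    case 9 then show ?case by (simp add: fmult_lunit inv_objD)
  next
    case 10 then show ?case by (simp add: fmult_runit inv_objD)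
  next
    case 11 then show ?case by (simp add: fmult_sym inv_objD)
  qed
qed

section \<open>Preservation of identity functors and composites\<close>

lemma inv_fobj_id: "inv_fobj (id_smfunctor C) X = X"
  by (simp add: inv_fobj_def id_smfunctor_def)

lemma inv_fobj_comp: "inv_fobj (comp_smfunctor E G F) X = inv_fobj G (inv_fobj F X)"
  by (simp add: inv_fobj_def comp_smfunctor_def)

text \<open>An equality of records, valid on all arguments, so it can rewrite statements about
  monoidal transformations directly; the same holds for composites below.\<close>

lemma Inv_functor_id: "Inv_functor C C (id_smfunctor C) = id_smfunctor (Inv C)"
  by (auto simp: Inv_functor_def inv_fobj_id[abs_def] fun_eq_iff)
    (auto simp: id_smfunctor_def fun_eq_iff)

text \<open>Objects over the middle category \<open>D\<close> occur in the composite structure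
  arrows only as inner endpoints, which composition in \<open>Inv E\<close> discards.\<close>

lemma Inv_functor_comp:
  "Inv_functor C E (comp_smfunctor E G F) =
     comp_smfunctor (Inv E) (Inv_functor D E G) (Inv_functor C D F)"
  by (auto simp: Inv_functor_def inv_fobj_comp[abs_def] fun_eq_iff)
    (auto simp: comp_smfunctor_def fun_eq_iff)

text \<open>Naturality of \<open>\<alpha>\<close> at the involutions makes each component
  equivariant; the other conditions hold on middle components.\<close>

lemma monoidal_transformation_Inv:
  assumes "monoidal_transformation C D F G \<alpha>"
  shows "monoidal_transformation (Inv C) (Inv D) (Inv_functor C D F) (Inv_functor C D G)
    (\<lambda>X. (inv_fobj F X, \<alpha> (fst X), inv_fobj G X))"
proof -
  interpret monoidal_transformation C D F G \<alpha> by fact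
  have C: "category C" and D: "category D" by unfold_locales
  interpret IF: symmetric_monoidal_functor "Inv C" "Inv D" "Inv_functor C D F"
    by (rule symmetric_monoidal_functor_Inv) unfold_locales
  interpret IG: symmetric_monoidal_functor "Inv C" "Inv D" "Inv_functor C D G"
    by (rule symmetric_monoidal_functor_Inv) unfold_locales
  have \<alpha>: "equivariant D (inv_fobj F X) (inv_fobj G X) (\<alpha> (fst X))" if "X \<in> inv_obj C" for X
    using that
    by (intro equivariantI)
      (simp_all add: F.inv_fobj_obj G.inv_fobj_obj component_hom inv_objD(1) naturality[OF inv_objD(2)])
  show ?thesis
  proof (unfold_locales, goal_cases)
    case 1 then show ?case by (simp add: hom_Inv_triple[OF D] \<alpha>)
  next
    case 2 then show ?case by (auto simp: hom_Inv[OF C] naturality[OF equivariantD(3)])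
  next
    case 3 then show ?case by (simp add: component_mult inv_objD)
  next
    case 4 then show ?case by (simp add: component_unit)
  qed
qed

text \<open>The unit and counit are lifted as monoidal transformations, and the triangle identities
  hold on middle components.\<close>

lemma symmetric_monoidal_adjunction_Inv:
  assumes "symmetric_monoidal_adjunction C D F G \<eta> \<epsilon>"
  shows "symmetric_monoidal_adjunction (Inv C) (Inv D) (Inv_functor C D F) (Inv_functor D C G)
    (\<lambda>X. (X, \<eta> (fst X), inv_fobj G (inv_fobj F X)))
    (\<lambda>X. (inv_fobj F (inv_fobj G X), \<epsilon> (fst X), X))"
proof -
  interpret symmetric_monoidal_adjunction C D F G \<eta> \<epsilon> by fact
  \<comment> \<open>At first the source and target are the lifts of the identity and of the
    composite; rewriting then turns them into the identity and the composite of the lifts, as the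
    adjunction demands.\<close>
  have "monoidal_transformation (Inv C) (Inv C)
      (Inv_functor C C (id_smfunctor C)) (Inv_functor C C (comp_smfunctor C G F))
      (\<lambda>X. (inv_fobj (id_smfunctor C) X, \<eta> (fst X), inv_fobj (comp_smfunctor C G F) X))"
    by (rule monoidal_transformation_Inv) (rule unit.monoidal_transformation_axioms)
  then have unit: "monoidal_transformation (Inv C) (Inv C) (id_smfunctor (Inv C))
      (comp_smfunctor (Inv C) (Inv_functor D C G) (Inv_functor C D F))
      (\<lambda>X. (X, \<eta> (fst X), inv_fobj G (inv_fobj F X)))"
    \<comment> \<open>The middle category occurs only on the right of
      \<open>Inv_functor_comp\<close>, so it has to be supplied.\<close>
    unfolding Inv_functor_id Inv_functor_comp[where D = D] inv_fobj_id inv_fobj_comp .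
  have "monoidal_transformation (Inv D) (Inv D)
      (Inv_functor D D (comp_smfunctor D F G)) (Inv_functor D D (id_smfunctor D))
      (\<lambda>X. (inv_fobj (comp_smfunctor D F G) X, \<epsilon> (fst X), inv_fobj (id_smfunctor D) X))"
    by (rule monoidal_transformation_Inv) (rule counit.monoidal_transformation_axioms)
  then have counit: "monoidal_transformation (Inv D) (Inv D)
      (comp_smfunctor (Inv D) (Inv_functor C D F) (Inv_functor D C G)) (id_smfunctor (Inv D))
      (\<lambda>X. (inv_fobj F (inv_fobj G X), \<epsilon> (fst X), X))"
    unfolding Inv_functor_id Inv_functor_comp[where D = C] inv_fobj_id inv_fobj_comp .
  show ?thesis
  proof (intro symmetric_monoidal_adjunction.intro symmetric_monoidal_adjunction_axioms.intro)
    show "symmetric_monoidal_functor (Inv C) (Inv D) (Inv_functor C D F)"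
      by (rule symmetric_monoidal_functor_Inv) (rule left.symmetric_monoidal_functor_axioms)
    show "symmetric_monoidal_functor (Inv D) (Inv C) (Inv_functor D C G)"
      by (rule symmetric_monoidal_functor_Inv) (rule right.symmetric_monoidal_functor_axioms)
  qed (use unit counit triangle_left triangle_right in \<open>simp_all add: inv_objD(1)\<close>)
qed

section \<open>Assembling the model of linear logic\<close>

theorem mainTheorem1:
  fixes \<L> :: "('o, 'a) smc"
  assumes "linear_category_of_model TYPE('p) TYPE('b) \<L>"
  shows "linear_category_of_model TYPE(('p, 'b) iobj) TYPE(('p, 'b) iarr) (Inv \<L>)"
proof -
  obtain ihom ev bot and \<M> :: "('p, 'b) smc" and pr1 pr2 L M \<eta> \<epsilon>
    where "linear_logic_model \<L> ihom ev bot \<M> pr1 pr2 L M \<eta> \<epsilon>"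
    using assms by (auto simp: linear_category_of_model_def)
  then interpret linear_logic_model \<L> ihom ev bot \<M> pr1 pr2 L M \<eta> \<epsilon> .
  have cat: "category \<L>" by unfold_locales
  have "has_terminal (Inv \<L>)"
    using linear_terminal is_terminal_Inv[OF cat] by (auto simp: has_terminal_def)
  \<comment> \<open>The instantiated introduction rule of the locale names a witness for each
    existential quantifier, with \<open>Inv \<M>\<close> as the Cartesian category.\<close>
  then show ?thesis
    unfolding linear_category_of_model_def
    using linear_logic_model.intro[OF
        star_autonomous_category_Inv[OF linear.star_autonomous_category_axioms]
        cartesian_category_Inv[OF nonlinear.cartesian_category_axioms]
        symmetric_monoidal_adjunction_Inv[OF adjunction.symmetric_monoidal_adjunction_axioms]
        linear_logic_model_axioms.intro[OF has_binary_products_Inv[OF cat linear_products]]]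
    by blast
qed

end
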